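(* Let $\varphi_1,\varphi_2\in L_2(\mathbb{R})$ be two functions such that the family $\left(\varphi_i(\cdot-k)\right)_{i\in\{1,2\},\,k\in\mathbb{Z}}$ is a Riesz basis. Assume that $$\beta^2(t)=\sum_{k\in\mathbb{Z}} a_k\,\varphi_1(t-k)+b_k\,\varphi_2(t-k),\qquad \beta^3(t)=\sum_{k\in\mathbb{Z}} c_k\,\varphi_1(t-k)+d_k\,\varphi_2(t-k),$$ where $\beta^2$ and $\beta^3$ are the quadratic and cubic B-splines and where the sequences $a,b,c,d$ satisfy $$\sum_{k\in\mathbb{Z}} |k|^3\left(|a_k|+|b_k|+|c_k|+|d_k|\right)<\infty .$$ Then $$|\mathrm{Supp}\,\varphi_1|+|\mathrm{Supp}\,\varphi_2|\ \geq\ 4 .$$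
   Context: The family $(\varphi_i(\cdot-k))_{i=1,\dots,N,\,k\in\mathbb{Z}}$ is a Riesz basis (of the space it generates) if there are constants $0<A\le B<\infty$ such that $A\sum_{i=1}^{N}\sum_{k} c_i[k]^2\le \big\|\sum_{i=1}^{N}\sum_{k} c_i[k]\varphi_i(\cdot-k)\big\|_{L_2}^2\le B\sum_{i=1}^{N}\sum_{k} c_i[k]^2$ for all $c_1,\dots,c_N\in\ell_2(\mathbb{Z})$. The polynomial B-spline $\beta^{n}$ of degree $n$ (order $n+1$) is the compactly supported function with Fourier transform $\widehat{\beta^{n}}(\omega)=\left(\frac{1-\mathrm{e}^{-\mathrm{j}\omega}}{\mathrm{j}\omega}\right)^{n+1}$, where $\widehat f(\omega)=\int_{\mathbb{R}} f(t)\mathrm{e}^{-\mathrm{j}\omega t}\,\mathrm{d}t$ and $\mathrm{j}$ is the imaginary unit; its support is $[0,n+1]$. The equalities in the statement are equalities in $L_2(\mathbb{R})$. $|\mathrm{Supp}\,\varphi|$ denotes the size of the support of $\varphi$, that is, the length of the smallest closed interval containing the (essential) support of $\varphi$, equal to $\infty$ if $\varphi$ is not compactly supported. *)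

theory Defs
  imports "HOL-Analysis.Analysis"
begin

section \<open>\<open>L\<^sub>2\<close> on the real line and sums of families\<close>

text \<open>
  Elements of \<open>L\<^sub>2(\<real>)\<close> are given by Borel representatives, and all notions below only depend on
  the representative up to equality almost everywhere.
\<close>

definition square_integrable :: "(real \<Rightarrow> real) \<Rightarrow> bool" where
  "square_integrable f \<longleftrightarrow>
     f \<in> borel_measurable lborel \<and> integrable lborel (\<lambda>t. (f t)\<^sup>2)"

definition L2_norm :: "(real \<Rightarrow> real) \<Rightarrow> real" where
  "L2_norm f = sqrt (\<integral>t. (f t)\<^sup>2 \<partial>lborel)"

text \<open>
  Unconditional convergence in \<open>L\<^sub>2\<close> of the family \<open>F\<close> over \<open>S\<close> to \<open>f\<close>. Square-integrability is
  demanded explicitly because the Bochner integral of a non-integrable function is 0.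
\<close>

definition has_L2_sum :: "('i \<Rightarrow> real \<Rightarrow> real) \<Rightarrow> (real \<Rightarrow> real) \<Rightarrow> 'i set \<Rightarrow> bool" where
  "has_L2_sum F f S \<longleftrightarrow>
     square_integrable f \<and> (\<forall>i\<in>S. square_integrable (F i)) \<and>
     ((\<lambda>K. L2_norm (\<lambda>t. f t - (\<Sum>i\<in>K. F i t))) \<longlongrightarrow> 0) (finite_subsets_at_top S)"

definition ell2 :: "(int \<Rightarrow> real) \<Rightarrow> bool" where
  "ell2 c \<longleftrightarrow> (\<lambda>k. (c k)\<^sup>2) summable_on UNIV"

text \<open>
  The integer shifts of \<open>\<phi> 1, \<dots>, \<phi> N\<close> form a Riesz basis of the space they generate. The witness
  \<open>f\<close> is the \<open>L\<^sub>2\<close> sum of all \<open>c i k * \<phi> i (t - k)\<close>.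
\<close>

definition riesz_basis_shifts :: "nat \<Rightarrow> (nat \<Rightarrow> real \<Rightarrow> real) \<Rightarrow> bool" where
  "riesz_basis_shifts N \<phi> \<longleftrightarrow>
     (\<exists>A B. 0 < A \<and> A \<le> B \<and>
       (\<forall>c. (\<forall>i\<in>{1..N}. ell2 (c i)) \<longrightarrow>
         (\<exists>f. has_L2_sum (\<lambda>(i, k) t. c i k * \<phi> i (t - real_of_int k)) f ({1..N} \<times> UNIV) \<and>
              A * (\<Sum>i=1..N. \<Sum>\<^sub>\<infinity>k. (c i k)\<^sup>2) \<le> (L2_norm f)\<^sup>2 \<and>
              (L2_norm f)\<^sup>2 \<le> B * (\<Sum>i=1..N. \<Sum>\<^sub>\<infinity>k. (c i k)\<^sup>2))))"

section \<open>Essential support and its size\<close>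

definition ess_support :: "(real \<Rightarrow> real) \<Rightarrow> real set" where
  "ess_support f = - \<Union>{U. open U \<and> (AE t in lborel. t \<in> U \<longrightarrow> f t = 0)}"

text \<open>
  The infimum is attained by the smallest compact interval containing the essential support; it is
  \<open>\<infinity>\<close> (infimum of the empty set) when there is no such interval.
\<close>

definition supp_size :: "(real \<Rightarrow> real) \<Rightarrow> ennreal" where
  "supp_size f = (INF (a, b) \<in> {(a, b). a \<le> b \<and> ess_support f \<subseteq> {a..b}}. ennreal (b - a))"

section \<open>B-splines\<close>

definition fourier :: "(real \<Rightarrow> real) \<Rightarrow> real \<Rightarrow> complex" where
  "fourier f \<omega> = (\<integral>t. complex_of_real (f t) * exp (- (\<i> * complex_of_real (\<omega> * t))) \<partial>lborel)"

text \<open>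
  \<open>is_bspline n f\<close>: \<open>f\<close> represents the polynomial B-spline of degree \<open>n\<close>. The singularity of the
  prescribed transform at 0 is removable, with value 1; integrability makes the transform
  meaningful and, by injectivity of the Fourier transform, \<open>f\<close> unique almost everywhere.
\<close>

definition is_bspline :: "nat \<Rightarrow> (real \<Rightarrow> real) \<Rightarrow> bool" where
  "is_bspline n f \<longleftrightarrow>
     integrable lborel f \<and> compact (ess_support f) \<and>
     (\<forall>\<omega>. fourier f \<omega> =
        (if \<omega> = 0 then 1
         else ((1 - exp (- (\<i> * complex_of_real \<omega>))) / (\<i> * complex_of_real \<omega>)) ^ (n + 1)))"

text \<open>Such functions exist: they are the iterated convolutions of the indicator of \<open>[0, 1]\<close>.\<close>

lemma compact_ess_support:
  assumes "AE t in lborel. R < \<bar>t\<bar> \<longrightarrow> f t = 0"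
  shows "compact (ess_support f)"
proof -
  have "open {t::real. R < \<bar>t\<bar>}"
    by (intro open_Collect_less continuous_intros)
  then have "{t. R < \<bar>t\<bar>} \<in> {U. open U \<and> (AE t in lborel. t \<in> U \<longrightarrow> f t = 0)}"
    using assms by simp
  then have "ess_support f \<subseteq> - {t. R < \<bar>t\<bar>}"
    unfolding ess_support_def by blast
  also have "\<dots> \<subseteq> {-R..R}" by auto
  finally have "ess_support f \<subseteq> {-R..R}" .
  then have "bounded (ess_support f)"
    by (rule bounded_subset[rotated]) (rule bounded_closed_interval)
  moreover have "closed (ess_support f)"
    unfolding ess_support_def by (intro closed_Compl open_Union) auto
  ultimately show ?thesis by (simp add: compact_eq_bounded_closed)
qed

lemma fourier_unit_interval:
  "fourier (indicator {0..1}) \<omega> =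
     (if \<omega> = 0 then 1
      else (1 - exp (- (\<i> * complex_of_real \<omega>))) / (\<i> * complex_of_real \<omega>))"
proof (cases "\<omega> = 0")
  case True
  have "(\<integral>t. complex_of_real (indicator {0..1::real} t) \<partial>lborel) = 1"
    by (subst integral_complex_of_real) simp
  then show ?thesis using True by (simp add: fourier_def)
next
  case False
  define G where "G t = - exp (- (\<i> * complex_of_real (\<omega> * t))) / (\<i> * complex_of_real \<omega>)" for t
  have G: "(G has_vector_derivative exp (- (\<i> * complex_of_real (\<omega> * t)))) (at t within {0..1})" for t
  proof -
    have "((\<lambda>z. - exp (- (\<i> * (complex_of_real \<omega> * z))) / (\<i> * complex_of_real \<omega>))
            has_field_derivative exp (- (\<i> * (complex_of_real \<omega> * complex_of_real t))))
            (at (complex_of_real t))"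
      using False by (auto intro!: derivative_eq_intros simp: field_simps)
    from has_vector_derivative_real_field[OF this] show ?thesis by (simp add: G_def[abs_def])
  qed
  have "(\<integral>t. indicator {0..1} t *\<^sub>R exp (- (\<i> * complex_of_real (\<omega> * t))) \<partial>lborel) = G 1 - G 0"
    by (rule integral_FTC_Icc) (use G in \<open>auto intro!: continuous_intros\<close>)
  then show ?thesis using False by (simp add: fourier_def scaleR_conv_of_real G_def field_simps)
qed

lemma convolution_unit_interval:
  assumes f: "integrable lborel f"
  defines "g \<equiv> \<lambda>t. \<integral>s. indicator {0..1} s * f (t - s) \<partial>lborel"
  shows "integrable lborel g" "fourier g \<omega> = fourier (indicator {0..1}) \<omega> * fourier f \<omega>"
proof -
  have f_meas [measurable]: "f \<in> borel_measurable borel"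
    using f by auto
  have shift: "integrable lborel (\<lambda>t. f (t - s))" for s
    using lborel_integrable_real_affine[OF f, of 1 "-s"] by simp
  have norm_shift: "(\<integral>t. \<bar>f (t - s)\<bar> \<partial>lborel) = (\<integral>t. \<bar>f t\<bar> \<partial>lborel)" for s
    using lborel_integral_real_affine[of 1 "\<lambda>t. \<bar>f t\<bar>" "-s"] by simp
  define F where
    "F = (\<lambda>(s, t). indicator {0..1::real} s * f (t - s))"
  have F: "integrable (lborel \<Otimes>\<^sub>M lborel) F"
  proof (rule lborel_pair.Fubini_integrable)
    show "F \<in> borel_measurable (lborel \<Otimes>\<^sub>M lborel)" unfolding F_def by measurable
    show "integrable lborel (\<lambda>s. \<integral>t. norm (F (s, t)) \<partial>lborel)"
      by (simp add: F_def abs_mult norm_shift)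
    show "AE s in lborel. integrable lborel (\<lambda>t. F (s, t))"
      by (simp add: F_def shift)
  qed
  have "integrable lborel (\<lambda>t. \<integral>s. F (s, t) \<partial>lborel)"
    using lborel_pair.integrable_snd[of "curry F"] F by (simp add: split_beta')
  then show "integrable lborel g" by (simp add: F_def g_def)
  define e where "e t = exp (- (\<i> * complex_of_real (\<omega> * t)))" for t
  have e_meas [measurable]: "e \<in> borel_measurable borel"
    unfolding e_def by (intro borel_measurable_continuous_onI continuous_intros)
  have norm_e: "norm (e t) = 1" for t by (simp add: e_def)
  have e_add: "e (s + t) = e s * e t" for s t by (simp add: e_def ring_distribs flip: exp_add)
  define H where "H s t = complex_of_real (F (s, t)) * e t" for s t
  have H: "integrable (lborel \<Otimes>\<^sub>M lborel) (case_prod H)"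
  proof (rule Bochner_Integration.integrable_bound[OF F])
    have F_meas [measurable]: "F \<in> borel_measurable (lborel \<Otimes>\<^sub>M lborel)" using F by auto
    show "case_prod H \<in> borel_measurable (lborel \<Otimes>\<^sub>M lborel)" unfolding H_def by measurable
    show "AE x in lborel \<Otimes>\<^sub>M lborel. norm (case_prod H x) \<le> norm (F x)"
      by (auto simp: H_def norm_mult norm_e)
  qed
  have "fourier g \<omega> = (\<integral>t. \<integral>s. H s t \<partial>lborel \<partial>lborel)"
    unfolding fourier_def g_def H_def F_def e_def[symmetric]
    by (simp flip: integral_complex_of_real)
  also have "\<dots> = (\<integral>s. \<integral>t. H s t \<partial>lborel \<partial>lborel)"
    using lborel_pair.Fubini_integral[OF H] .
  also have "\<dots> = (\<integral>s. (indicator {0..1} s * e s) * fourier f \<omega> \<partial>lborel)"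
  proof (rule Bochner_Integration.integral_cong[OF refl])
    fix s
    have "(\<integral>t. H s t \<partial>lborel) = (\<integral>t. H s (s + t) \<partial>lborel)"
      using lborel_integral_real_affine[of 1 "H s" s] by simp
    also have "\<dots> = (\<integral>t. (indicator {0..1} s * e s) * (complex_of_real (f t) * e t) \<partial>lborel)"
      by (intro Bochner_Integration.integral_cong) (auto simp: H_def F_def e_add split: split_indicator)
    also have "\<dots> = (indicator {0..1} s * e s) * fourier f \<omega>"
      by (simp add: fourier_def e_def)
    finally show "(\<integral>t. H s t \<partial>lborel) = (indicator {0..1} s * e s) * fourier f \<omega>" .
  qed
  also have "\<dots> = fourier (indicator {0..1}) \<omega> * fourier f \<omega>"
  proof -
    have "complex_of_real (indicator {0..1} s) = indicator {0..1} s" for s :: real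
      by (simp split: split_indicator)
    then show ?thesis by (simp add: fourier_def e_def)
  qed
  finally show "fourier g \<omega> = fourier (indicator {0..1}) \<omega> * fourier f \<omega>" .
qed

lemma is_bspline_exists: "\<exists>f. is_bspline n f"
proof -
  have "\<exists>f R. integrable lborel f \<and> (AE t in lborel. R < \<bar>t\<bar> \<longrightarrow> f t = 0) \<and>
          (\<forall>\<omega>. fourier f \<omega> = fourier (indicator {0..1}) \<omega> ^ (n + 1))"
  proof (induction n)
    case 0
    show ?case
      by (rule exI[of _ "indicator {0..1}"], rule exI[of _ 1]) (auto split: split_indicator)
  next
    case (Suc n)
    then obtain f R where f: "integrable lborel f"
      and supp: "AE t in lborel. R < \<bar>t\<bar> \<longrightarrow> f t = 0"
      and four: "\<And>\<omega>. fourier f \<omega> = fourier (indicator {0..1}) \<omega> ^ (n + 1)"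
      by blast
    define g where "g t = (\<integral>s. indicator {0..1} s * f (t - s) \<partial>lborel)" for t
    have f_meas [measurable]: "f \<in> borel_measurable borel"
      using f by auto
    have "g t = 0" if t: "R + 1 < \<bar>t\<bar>" for t
    proof -
      have "AE s in lborel. R < \<bar>t + (-1) * s\<bar> \<longrightarrow> f (t + (-1) * s) = 0"
        using supp by (intro AE_borel_affine) auto
      then have "AE s in lborel. indicator {0..1} s * f (t - s) = 0"
        by eventually_elim (use t in \<open>auto split: split_indicator\<close>)
      then show ?thesis unfolding g_def by (rule integral_eq_zero_AE)
    qed
    then show ?case
      using convolution_unit_interval[OF f] four
      by (intro exI[of _ g] exI[of _ "R + 1"]) (auto simp: g_def[abs_def])
  qed
  then obtain f R where "integrable lborel f" "AE t in lborel. R < \<bar>t\<bar> \<longrightarrow> f t = 0"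
      "\<And>\<omega>. fourier f \<omega> = fourier (indicator {0..1}) \<omega> ^ (n + 1)"
    by blast
  then have "is_bspline n f"
    unfolding is_bspline_def
    by (simp add: compact_ess_support fourier_unit_interval del: power_Suc)
  then show ?thesis by blast
qed

end

theory Submission
  imports Defs "HOL-Probability.Levy"
begin

text \<open>
  The bound comes from counting dimensions on a short interval, where the shifts of the two functions must be
  numerous enough to reproduce all the pieces of the cubic B-spline. An integer shift of a function supported in
  an interval of length \<open>L\<close> covers a point of \<open>\<real>\<close> for \<open>L\<close> indices
  on average. If the support lengths of \<open>\<phi> 1\<close> and \<open>\<phi> 2\<close> add up to less than
  4, then some point \<open>x\<close> has at most 3 shifts of the two functions that are nonzero just to the
  right of \<open>x\<close> (\<open>ex_point_few_shifts\<close>, \<open>shifts_right_of_point\<close>). On a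
  small interval \<open>(x, y)\<close> every expansion in the shifts is then a combination of these functions:
  an \<open>L\<^sub>2\<close> limit of partial sums that are eventually constant on the interval equals that
  constant there (\<open>has_L2_sum_eq_finite_sum_on\<close>). In particular the 4 shifts of the cubic B-spline
  that are nonzero on the unit interval between consecutive integers that contains \<open>(x, y)\<close> lie, on
  \<open>(x, y)\<close>, in a space of dimension at most 3 and hence are linearly dependent there. But they are
  4 linearly independent cubic polynomials (\<open>cubic_bspline_shifts_independent\<close>), a contradiction.

  The B-spline is given by its Fourier transform, so its polynomial pieces have to be recovered. The iterated
  backward differences of truncated powers satisfy the recursion of the B-splines under convolution with the
  indicator of the unit interval, so they have the same Fourier transform (\<open>bspline_fourier\<close>);
  injectivity of the Fourier transform on integrable functions (\<open>fourier_inject\<close>) identifies the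
  two almost everywhere. Injectivity in turn comes from Levy's uniqueness theorem for characteristic functions
  of probability distributions.
\<close>

section \<open>Injectivity of the Fourier transform\<close>

lemma integrable_fourier:
  fixes f :: "real \<Rightarrow> real"
  assumes "integrable lborel f"
  shows "integrable lborel (\<lambda>t. complex_of_real (f t) * exp (- (\<i> * complex_of_real (\<omega> * t))))"
proof (rule Bochner_Integration.integrable_bound[OF assms])
  have [measurable]: "f \<in> borel_measurable borel" using assms by auto
  have [measurable]: "(\<lambda>t. exp (- (\<i> * complex_of_real (\<omega> * t)))) \<in> borel_measurable borel"
    by (intro borel_measurable_continuous_onI continuous_intros)
  show "(\<lambda>t. complex_of_real (f t) * exp (- (\<i> * complex_of_real (\<omega> * t)))) \<in> borel_measurable lborel"
    by measurable
qed (simp add: norm_mult)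

lemma fourier_add:
  assumes "integrable lborel f" "integrable lborel g"
  shows "fourier (\<lambda>t. f t + g t) \<omega> = fourier f \<omega> + fourier g \<omega>"
  using integrable_fourier[OF assms(1)] integrable_fourier[OF assms(2)]
  by (simp add: fourier_def distrib_right)

lemma fourier_0: "fourier f 0 = complex_of_real (\<integral>t. f t \<partial>lborel)"
  by (simp add: fourier_def)

lemma real_distribution_density:
  fixes p :: "real \<Rightarrow> real"
  assumes p: "integrable lborel p" "\<And>t. 0 \<le> p t" and c: "(\<integral>t. p t \<partial>lborel) = c" "0 < c"
  shows "real_distribution (density lborel (\<lambda>t. ennreal (p t / c)))"
    and "char (density lborel (\<lambda>t. ennreal (p t / c))) \<omega> = fourier p (- \<omega>) / c"
proof -
  have [measurable]: "p \<in> borel_measurable borel" using p by auto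
  have "(\<integral>\<^sup>+t. ennreal (p t / c) \<partial>lborel) = ennreal (\<integral>t. p t / c \<partial>lborel)"
    using p c by (intro nn_integral_eq_integral) auto
  also have "\<dots> = 1" using c by simp
  finally have "prob_space (density lborel (\<lambda>t. ennreal (p t / c)))"
    by (intro prob_spaceI) (simp add: emeasure_density)
  then show "real_distribution (density lborel (\<lambda>t. ennreal (p t / c)))"
    by (simp add: real_distribution_def real_distribution_axioms_def)
  have [measurable]: "(\<lambda>t. iexp (\<omega> * t)) \<in> borel_measurable borel"
    by (intro borel_measurable_continuous_onI continuous_intros)
  have "char (density lborel (\<lambda>t. ennreal (p t / c))) \<omega>
      = (\<integral>t. (p t / c) *\<^sub>R iexp (\<omega> * t) \<partial>lborel)"
    unfolding char_def using p c by (intro integral_density) auto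
  also have "\<dots> = (\<integral>t. (complex_of_real (p t) * iexp (\<omega> * t)) / c \<partial>lborel)"
    by (simp add: scaleR_conv_of_real)
  also have "\<dots> = fourier p (- \<omega>) / c"
    by (simp add: fourier_def)
  finally show "char (density lborel (\<lambda>t. ennreal (p t / c))) \<omega> = fourier p (- \<omega>) / c" .
qed

text \<open>
  The transforms at 0 are the total masses, so both functions are normalised to probability
  densities by the same constant; the densities are then determined by their characteristic functions.
\<close>

lemma fourier_inject_nonneg:
  fixes p q :: "real \<Rightarrow> real"
  assumes p: "integrable lborel p" "\<And>t. 0 \<le> p t" and q: "integrable lborel q" "\<And>t. 0 \<le> q t"
    and pos: "0 < (\<integral>t. p t \<partial>lborel)" and eq: "fourier p = fourier q"
  shows "AE t in lborel. p t = q t"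
proof -
  define c where "c = (\<integral>t. p t \<partial>lborel)"
  have c: "0 < c" using pos by (simp add: c_def)
  have qc: "(\<integral>t. q t \<partial>lborel) = c"
    using fun_cong[OF eq, of 0] by (simp add: fourier_0 c_def)
  have [measurable]: "p \<in> borel_measurable borel" "q \<in> borel_measurable borel" using p q by auto
  note P = real_distribution_density[OF p c_def[symmetric] c]
  note Q = real_distribution_density[OF q qc c]
  have "density lborel (\<lambda>t. ennreal (p t / c)) = density lborel (\<lambda>t. ennreal (q t / c))"
    by (rule Levy_uniqueness[OF P(1) Q(1)]) (simp add: fun_eq_iff P(2) Q(2) eq)
  then have "AE t in lborel. ennreal (p t / c) = ennreal (q t / c)"
    by (subst (asm) sigma_finite_measure.density_unique_iff[OF sigma_finite_lborel]) auto
  then show ?thesis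
    by eventually_elim (use p q c in simp)
qed

text \<open>
  A common summand \<open>h\<close> that dominates the negative parts of \<open>f\<close> and \<open>g\<close> reduces signed functions to nonnegative
  ones. The indicator in \<open>h\<close> makes the total mass positive, so that normalisation is possible.
\<close>

lemma fourier_inject:
  assumes f: "integrable lborel f" and g: "integrable lborel g" and eq: "fourier f = fourier g"
  shows "AE t in lborel. f t = g t"
proof -
  define h where "h t = \<bar>f t\<bar> + \<bar>g t\<bar> + indicator {0..1} t" for t :: real
  have h: "integrable lborel h" unfolding h_def using f g by simp
  have fh: "integrable lborel (\<lambda>t. f t + h t)" and gh: "integrable lborel (\<lambda>t. g t + h t)"
    using f g h by auto
  have nonneg: "0 \<le> f t + h t" "0 \<le> g t + h t" for t
    using abs_ge_minus_self[of "f t"] abs_ge_minus_self[of "g t"] abs_ge_zero[of "f t"]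
      abs_ge_zero[of "g t"] by (auto simp: h_def split: split_indicator)
  have "(1::real) = measure lborel {0..1::real}" by simp
  also have "\<dots> = (\<integral>t. indicator {0..1::real} t \<partial>lborel)"
    by (subst Bochner_Integration.integral_indicator) auto
  also have "\<dots> \<le> (\<integral>t. f t + h t \<partial>lborel)"
    using fh by (intro integral_mono) (auto simp: h_def)
  finally have pos: "0 < (\<integral>t. f t + h t \<partial>lborel)" by simp
  have "AE t in lborel. f t + h t = g t + h t"
    by (rule fourier_inject_nonneg[OF fh _ gh _ pos])
      (use nonneg in \<open>auto simp: fun_eq_iff fourier_add[OF f h] fourier_add[OF g h] eq\<close>)
  then show ?thesis by simp
qed

section \<open>B-splines as differences of truncated powers\<close>

definition trunc_pow :: "nat \<Rightarrow> real \<Rightarrow> real" where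
  "trunc_pow n t = (if 0 < t then t ^ n / fact n else 0)"

definition backward_diff :: "(real \<Rightarrow> real) \<Rightarrow> real \<Rightarrow> real" where
  "backward_diff f t = f t - f (t - 1)"

text \<open>
  The classical formula \<open>\<Sum>i\<le>n+1. (-1)^i * (n+1 choose i) * trunc_pow n (t - i)\<close>, kept as an
  iterated difference because differences commute with averaging.
\<close>

definition bspline :: "nat \<Rightarrow> real \<Rightarrow> real" where
  "bspline n = (backward_diff ^^ Suc n) (trunc_pow n)"

lemma continuous_trunc_pow_Suc: "continuous_on A (trunc_pow (Suc n))"
proof -
  have "trunc_pow (Suc n) = (\<lambda>t. max 0 t ^ Suc n / fact (Suc n))"
    by (auto simp: fun_eq_iff trunc_pow_def max_def)
  then show ?thesis by (auto intro!: continuous_intros)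
qed

lemma trunc_pow_Suc_has_derivative:
  assumes "t \<noteq> 0"
  shows "(trunc_pow (Suc n) has_real_derivative trunc_pow n t) (at t)"
proof (cases "0 < t")
  case True
  have "((\<lambda>t. t ^ Suc n / fact (Suc n)) has_real_derivative trunc_pow n t) (at t)"
    using True DERIV_cdivide[OF DERIV_pow[of "Suc n" t], of "fact (Suc n)"]
    by (simp add: trunc_pow_def field_simps del: of_nat_Suc)
  then show ?thesis
    by (rule has_field_derivative_transform_within_open[where S = "{0<..}"])
      (use True in \<open>auto simp: trunc_pow_def\<close>)
next
  case False
  have "((\<lambda>t. 0) has_real_derivative trunc_pow n t) (at t)"
    using False by (auto simp: trunc_pow_def)
  then show ?thesis
    by (rule has_field_derivative_transform_within_open[where S = "{..<0}"])
      (use False assms in \<open>auto simp: trunc_pow_def\<close>)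
qed

text \<open>
  Averaging over the unit interval turns a derivative into a backward difference. The exceptional
  point is the jump of \<open>trunc_pow 0\<close>.
\<close>

lemma average_trunc_pow:
  "((\<lambda>s. trunc_pow n (t - s)) has_integral backward_diff (trunc_pow (Suc n)) t) {0..1}"
proof -
  have "((\<lambda>s. trunc_pow n (t - s)) has_integral
          - trunc_pow (Suc n) (t - 1) - - trunc_pow (Suc n) (t - 0)) {0..1}"
  proof (rule fundamental_theorem_of_calculus_interior_strong[where S = "{t}"])
    fix s assume "s \<in> {0<..<1} - {t}"
    then have "((\<lambda>s. - trunc_pow (Suc n) (t - s)) has_real_derivative - (trunc_pow n (t - s) * (0 - 1))) (at s)"
      by (intro DERIV_minus DERIV_chain2[OF trunc_pow_Suc_has_derivative] derivative_intros) auto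
    then show "((\<lambda>s. - trunc_pow (Suc n) (t - s)) has_vector_derivative trunc_pow n (t - s)) (at s)"
      by (simp add: has_real_derivative_iff_has_vector_derivative)
  next
    show "continuous_on {0..1} (\<lambda>s. - trunc_pow (Suc n) (t - s))"
      by (intro continuous_on_minus continuous_on_compose2[OF continuous_trunc_pow_Suc[of UNIV]]
            continuous_intros) auto
  qed auto
  then show ?thesis by (simp add: backward_diff_def)
qed

lemma average_backward_diff:
  assumes "\<And>t. ((\<lambda>s. f (t - s)) has_integral h t) {0..1}"
  shows "((\<lambda>s. (backward_diff ^^ m) f (t - s)) has_integral (backward_diff ^^ m) h t) {0..1}"
proof (induction m arbitrary: t)
  case 0
  show ?case using assms by simp
next
  case (Suc m)
  have "((\<lambda>s. (backward_diff ^^ m) f (t - s) - (backward_diff ^^ m) f (t - 1 - s)) has_integral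
          (backward_diff ^^ m) h t - (backward_diff ^^ m) h (t - 1)) {0..1}"
    by (intro has_integral_diff Suc.IH)
  then show ?case
    by (simp add: backward_diff_def[of "(backward_diff ^^ m) g" for g]
        cancel_ab_semigroup_add_class.diff_right_commute[of t 1])
qed

lemma average_bspline: "((\<lambda>s. bspline n (t - s)) has_integral bspline (Suc n) t) {0..1}"
  using average_backward_diff[OF average_trunc_pow, of "Suc n" n t]
  by (simp add: bspline_def funpow_swap1)

text \<open>
  By \<open>average_bspline\<close>, each degree is the convolution of the previous one with the indicator of the
  unit interval, which multiplies the transform by that of the indicator.
\<close>

lemma bspline_fourier:
  "integrable lborel (bspline n) \<and> (\<forall>\<omega>. fourier (bspline n) \<omega> = fourier (indicator {0..1}) \<omega> ^ Suc n)"
proof (induction n)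
  case 0
  have eq: "bspline 0 = indicator {0<..1}"
    by (auto simp: fun_eq_iff bspline_def backward_diff_def trunc_pow_def split: split_indicator)
  have "fourier (indicator {0<..1}) \<omega> = fourier (indicator {0..1}) \<omega>" for \<omega>
    unfolding fourier_def
  proof (rule integral_cong_AE)
    show "AE t in lborel. complex_of_real (indicator {0<..1} t) * exp (- (\<i> * complex_of_real (\<omega> * t)))
        = complex_of_real (indicator {0..1} t) * exp (- (\<i> * complex_of_real (\<omega> * t)))"
      using AE_lborel_singleton[of 0] by eventually_elim (auto split: split_indicator)
  qed (auto intro!: borel_measurable_integrable integrable_fourier simp del: of_real_indicator)
  then show ?case by (simp add: eq)
next
  case (Suc n)
  then have int: "integrable lborel (bspline n)"
    and four: "\<And>\<omega>. fourier (bspline n) \<omega> = fourier (indicator {0..1}) \<omega> ^ Suc n"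
    by auto
  have "bspline (Suc n) t = (\<integral>s. indicator {0..1} s * bspline n (t - s) \<partial>lborel)" for t
  proof -
    have "integrable lborel (\<lambda>s. bspline n (t - s))"
      using lborel_integrable_real_affine[OF int, of "-1" t] by simp
    then have "set_integrable lborel {0..1} (\<lambda>s. bspline n (t - s))"
      unfolding set_integrable_def by (intro integrable_mult_indicator) auto
    from set_borel_integral_eq_integral(2)[OF this] integral_unique[OF average_bspline[of n t]]
    show ?thesis by (simp add: set_lebesgue_integral_def)
  qed
  then have eq: "bspline (Suc n) = (\<lambda>t. \<integral>s. indicator {0..1} s * bspline n (t - s) \<partial>lborel)"
    by (simp add: fun_eq_iff)
  show ?case
    unfolding eq using convolution_unit_interval[OF int] by (simp add: four)
qed

lemma is_bspline_AE_eq: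
  assumes "is_bspline n f"
  shows "AE t in lborel. f t = bspline n t"
proof (rule fourier_inject)
  show "fourier f = fourier (bspline n)"
    using assms bspline_fourier[of n]
    by (auto simp: is_bspline_def fun_eq_iff fourier_unit_interval)
qed (use assms bspline_fourier[of n] in \<open>auto simp: is_bspline_def\<close>)

lemma cubic_bspline_pieces:
  assumes "0 < u" "u < 1"
  shows "bspline 3 u = u ^ 3 / 6"
    and "bspline 3 (u + 1) = (1 + 3 * u + 3 * u\<^sup>2 - 3 * u ^ 3) / 6"
    and "bspline 3 (u + 2) = (4 - 6 * u\<^sup>2 + 3 * u ^ 3) / 6"
    and "bspline 3 (u + 3) = (1 - 3 * u + 3 * u\<^sup>2 - u ^ 3) / 6"
  using assms
  by (simp_all add: bspline_def backward_diff_def trunc_pow_def eval_nat_numeral)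
     (simp_all add: field_simps)

text \<open>
  A combination of the four pieces is a cubic polynomial in \<open>u\<close>. Infinitely many zeros make its
  coefficients vanish, and these determine \<open>\<alpha>\<close>.
\<close>

lemma cubic_bspline_shifts_independent:
  assumes "infinite U" "U \<subseteq> {0<..<1}"
    and zero: "\<And>u. u \<in> U \<Longrightarrow> (\<Sum>j<4. \<alpha> j * bspline 3 (u + real j)) = 0"
    and "j < 4"
  shows "\<alpha> j = 0"
proof -
  \<comment> \<open>six times the combination, sorted by powers of \<open>u\<close>\<close>
  define p where
    "p = [:\<alpha> 1 + 4 * \<alpha> 2 + \<alpha> 3, 3 * \<alpha> 1 - 3 * \<alpha> 3, 3 * \<alpha> 1 - 6 * \<alpha> 2 + 3 * \<alpha> 3,
           \<alpha> 0 - 3 * \<alpha> 1 + 3 * \<alpha> 2 - \<alpha> 3:]"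
  have "poly p u = 0" if "u \<in> U" for u
  proof -
    have u: "0 < u" "u < 1" using that assms(2) by auto
    have "poly p u = 6 * (\<Sum>j<4. \<alpha> j * bspline 3 (u + real j))"
      using u
      by (simp add: p_def lessThan_nat_numeral lessThan_Suc cubic_bspline_pieces)
        (simp add: field_simps power2_eq_square power3_eq_cube)
    then show ?thesis using zero[OF that] by simp
  qed
  then have "U \<subseteq> {u. poly p u = 0}" by auto
  then have "p = 0"
    using assms(1) poly_roots_finite infinite_super by metis
  then have "\<alpha> 0 = 0 \<and> \<alpha> 1 = 0 \<and> \<alpha> 2 = 0 \<and> \<alpha> 3 = 0"
    by (auto simp: p_def)
  moreover have "j = 0 \<or> j = 1 \<or> j = 2 \<or> j = 3" using \<open>j < 4\<close> by linarith
  ultimately show ?thesis by auto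
qed

section \<open>Restricting an \<open>L\<^sub>2\<close> sum to a set\<close>

lemma square_integrable_lincomb:
  assumes "square_integrable f" "square_integrable g"
  shows "square_integrable (\<lambda>t. f t + c * g t)"
proof -
  have [measurable]: "f \<in> borel_measurable borel" "g \<in> borel_measurable borel"
    using assms by (auto simp: square_integrable_def)
  have bd: "(x + c * y)\<^sup>2 \<le> 2 * x\<^sup>2 + 2 * c\<^sup>2 * y\<^sup>2" for x y :: real
    using zero_le_power2[of "x - c * y"] by (simp add: power2_eq_square algebra_simps)
  have "integrable lborel (\<lambda>t. (f t + c * g t)\<^sup>2)"
    by (rule Bochner_Integration.integrable_bound[where f = "\<lambda>t. 2 * (f t)\<^sup>2 + 2 * c\<^sup>2 * (g t)\<^sup>2"])
      (use assms bd in \<open>auto simp: square_integrable_def\<close>)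
  then show ?thesis by (simp add: square_integrable_def)
qed

lemma square_integrable_sum:
  assumes "finite K" "\<And>i. i \<in> K \<Longrightarrow> square_integrable (F i)"
  shows "square_integrable (\<lambda>t. \<Sum>i\<in>K. F i t)"
  using assms
proof (induction K rule: finite_induct)
  case empty
  show ?case by (simp add: square_integrable_def)
next
  case (insert i K)
  then show ?case
    using square_integrable_lincomb[of "F i" "\<lambda>t. \<Sum>i\<in>K. F i t" 1] by simp
qed

text \<open>
  On \<open>I\<close> all partial sums over finite supersets of \<open>K\<close> agree. The squared error over \<open>I\<close> is thus
  eventually constant, while it is bounded by the squared error over \<open>\<real>\<close>, which tends to 0.
\<close>

lemma has_L2_sum_eq_finite_sum_on:
  assumes sum: "has_L2_sum F f S" and K: "finite K" "K \<subseteq> S" and I [measurable]: "I \<in> sets borel"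
    and vanish: "\<And>i. i \<in> S - K \<Longrightarrow> AE t in lborel. t \<in> I \<longrightarrow> F i t = 0"
  shows "AE t in lborel. t \<in> I \<longrightarrow> f t = (\<Sum>i\<in>K. F i t)"
proof -
  have sq: "square_integrable (\<lambda>t. f t - (\<Sum>i\<in>L. F i t))" if "finite L" "L \<subseteq> S" for L
    using square_integrable_lincomb[of f "\<lambda>t. \<Sum>i\<in>L. F i t" "-1"] square_integrable_sum[of L F]
      sum that by (auto simp: has_L2_sum_def)
  define r where "r t = indicator I t * (f t - (\<Sum>i\<in>K. F i t))\<^sup>2" for t
  have r: "integrable lborel r"
    using sq[OF K] integrable_mult_indicator[of I lborel "\<lambda>t. (f t - (\<Sum>i\<in>K. F i t))\<^sup>2"]
    by (simp add: r_def[abs_def] square_integrable_def)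
  have le: "(\<integral>t. r t \<partial>lborel) \<le> (L2_norm (\<lambda>t. f t - (\<Sum>i\<in>L. F i t)))\<^sup>2"
    if L: "finite L" "K \<subseteq> L" "L \<subseteq> S" for L
  proof -
    have "AE t in lborel. \<forall>i\<in>L - K. t \<in> I \<longrightarrow> F i t = 0"
      using L vanish by (intro AE_finite_allI) auto
    then have "AE t in lborel. r t \<le> (f t - (\<Sum>i\<in>L. F i t))\<^sup>2"
    proof eventually_elim
      case (elim t)
      show ?case
      proof (cases "t \<in> I")
        case True
        with elim have "(\<Sum>i\<in>L. F i t) = (\<Sum>i\<in>K. F i t)"
          using L by (intro sum.mono_neutral_right) auto
        then show ?thesis by (simp add: r_def True)
      qed (simp add: r_def)
    qed
    then have "(\<integral>t. r t \<partial>lborel) \<le> (\<integral>t. (f t - (\<Sum>i\<in>L. F i t))\<^sup>2 \<partial>lborel)"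
      using r sq[OF L(1,3)] by (intro integral_mono_AE) (auto simp: square_integrable_def)
    then show ?thesis by (simp add: L2_norm_def)
  qed
  have "((\<lambda>L. (L2_norm (\<lambda>t. f t - (\<Sum>i\<in>L. F i t)))\<^sup>2) \<longlongrightarrow> 0\<^sup>2) (finite_subsets_at_top S)"
    using sum by (intro tendsto_intros) (simp add: has_L2_sum_def)
  then have "(\<integral>t. r t \<partial>lborel) \<le> 0\<^sup>2"
    by (rule tendsto_lowerbound)
      (use K le in \<open>auto simp: eventually_finite_subsets_at_top\<close>)
  moreover have "0 \<le> (\<integral>t. r t \<partial>lborel)" by (intro integral_nonneg_AE) (simp add: r_def)
  ultimately have "(\<integral>t. r t \<partial>lborel) = 0" by simp
  then have "AE t in lborel. r t = 0"
    by (subst (asm) integral_nonneg_eq_0_iff_AE[OF r]) (simp_all add: r_def)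
  then show ?thesis by eventually_elim (auto simp: r_def split: split_indicator_asm)
qed

section \<open>Supports and overlapping shifts\<close>

text \<open>
  The complement of the essential support is a union of possibly uncountably many open null sets;
  by Lindelof's theorem countably many of them suffice.
\<close>

lemma AE_zero_outside_ess_support: "AE t in lborel. t \<notin> ess_support f \<longrightarrow> f t = 0"
proof -
  define \<U> where "\<U> = {U. open U \<and> (AE t in lborel. t \<in> U \<longrightarrow> f t = 0)}"
  obtain \<V> where V: "\<V> \<subseteq> \<U>" "countable \<V>" "\<Union>\<V> = \<Union>\<U>"
    by (rule Lindelof[of \<U>]) (auto simp: \<U>_def)
  have "AE t in lborel. \<forall>U\<in>\<V>. t \<in> U \<longrightarrow> f t = 0"
    using V by (intro AE_ball_countable') (auto simp: \<U>_def)
  moreover have "ess_support f = - \<Union>\<V>"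
    by (simp add: ess_support_def V(3) \<U>_def)
  ultimately show ?thesis by auto
qed

lemma AE_shifts_zero_outside:
  fixes f :: "real \<Rightarrow> real"
  assumes [measurable]: "f \<in> borel_measurable borel" and "ess_support f \<subseteq> {a..b}"
  shows "AE t in lborel. \<forall>k::int. t - real_of_int k \<notin> {a..b} \<longrightarrow> f (t - real_of_int k) = 0"
proof (subst AE_all_countable, intro allI)
  fix k :: int
  have "AE t in lborel. t \<notin> {a..b} \<longrightarrow> f t = 0"
    using AE_zero_outside_ess_support[of f] by eventually_elim (use assms(2) in auto)
  from AE_borel_affine[OF _ _ this, of 1 "- real_of_int k"]
  show "AE t in lborel. t - real_of_int k \<notin> {a..b} \<longrightarrow> f (t - real_of_int k) = 0"
    by simp
qed

lemma supp_size_add_less_obtain: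
  assumes "supp_size f + supp_size g < ennreal r" "0 \<le> r"
  obtains a b a' b' where "a \<le> b" "ess_support f \<subseteq> {a..b}" "a' \<le> b'" "ess_support g \<subseteq> {a'..b'}"
    "(b - a) + (b' - a') < r"
proof -
  have "supp_size f < top" "supp_size g < top"
    using assms by (auto simp: less_top[symmetric] top_add add_top)
  then have "supp_size f < ennreal r - supp_size g"
    using assms by (subst less_diff_eq_ennreal) auto
  then obtain a b where ab: "a \<le> b" "ess_support f \<subseteq> {a..b}" "ennreal (b - a) < ennreal r - supp_size g"
    unfolding supp_size_def[of f] by (auto simp: INF_less_iff)
  then have "ennreal (b - a) + supp_size g < ennreal r"
    by (subst (asm) less_diff_eq_ennreal) auto
  then have "supp_size g < ennreal r - ennreal (b - a)"
    by (subst less_diff_eq_ennreal) (auto simp: add.commute)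
  then obtain a' b' where ab': "a' \<le> b'" "ess_support g \<subseteq> {a'..b'}"
      "ennreal (b' - a') < ennreal r - ennreal (b - a)"
    unfolding supp_size_def[of g] by (auto simp: INF_less_iff)
  then have "ennreal (b' - a') + ennreal (b - a) < ennreal r"
    by (subst (asm) less_diff_eq_ennreal) auto
  then have "ennreal ((b' - a') + (b - a)) < ennreal r"
    using ab(1) ab'(1) by (subst ennreal_plus) auto
  then have "(b - a) + (b' - a') < r"
    using ab(1) ab'(1) by (subst (asm) ennreal_less_iff) auto
  with ab ab' that show ?thesis by blast
qed

text \<open>
  Only points to the right of \<open>x\<close> are considered: there the shift whose support ends at \<open>x\<close> no
  longer counts, which makes the index range half-open and the number of shifts a difference of floors.
\<close>

lemma shifts_right_of_point:
  fixes x a b :: real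
  shows "\<forall>\<^sub>F t in at_right x. \<forall>k. t - real_of_int k \<in> {a..b} \<longrightarrow> k \<in> {\<lfloor>x - b\<rfloor><..\<lfloor>x - a\<rfloor>}"
proof -
  have "x < real_of_int \<lfloor>x - a\<rfloor> + 1 + a" by linarith
  then have "\<forall>\<^sub>F t in at_right x. t < real_of_int \<lfloor>x - a\<rfloor> + 1 + a"
    by (intro eventually_at_right_less[THEN eventually_mono] order_tendstoD(2)[OF tendsto_ident_at])
  with eventually_at_right_less[of x] show ?thesis
    by eventually_elim (auto; linarith)
qed

text \<open>
  The number of shifts that are active just to the right of \<open>x\<close> has mean \<open>(b - a) + (b' - a')\<close> over a
  period, so it is somewhere at most this mean. It drops only at the integer translates of \<open>b\<close> and
  \<open>b'\<close>, so a minimum is attained at one of these two points, and it is enough to examine them.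
\<close>

lemma ex_point_few_shifts:
  fixes a b a' b' :: real
  assumes "a \<le> b" "a' \<le> b'" "(b - a) + (b' - a') < real_of_int N"
  obtains x where "(\<lfloor>x - a\<rfloor> - \<lfloor>x - b\<rfloor>) + (\<lfloor>x - a'\<rfloor> - \<lfloor>x - b'\<rfloor>) < N"
proof -
  have False
    if 1: "N \<le> (\<lfloor>b - a\<rfloor> - \<lfloor>b - b\<rfloor>) + (\<lfloor>b - a'\<rfloor> - \<lfloor>b - b'\<rfloor>)"
      and 2: "N \<le> (\<lfloor>b' - a\<rfloor> - \<lfloor>b' - b\<rfloor>) + (\<lfloor>b' - a'\<rfloor> - \<lfloor>b' - b'\<rfloor>)"
  proof -
    define D where "D = \<lfloor>b - b'\<rfloor>"
    have lengths: "\<lfloor>b - a\<rfloor> + \<lfloor>b' - a'\<rfloor> < N"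
      using assms(3) by linarith
    show False
    proof (cases "b - b' = real_of_int D")
      case True
      then have "\<lfloor>b' - b\<rfloor> = - D" "\<lfloor>b - a'\<rfloor> = \<lfloor>b' - a'\<rfloor> + D" by linarith+
      then show False using 1 lengths by (simp add: D_def)
    next
      case False
      \<comment> \<open>The counts bound \<open>b - a'\<close> and \<open>b' - a\<close> from below; these are the two lengths shifted by
        \<open>b - b'\<close> and by its negative, so the shift cancels in their sum.\<close>
      then have "\<lfloor>b' - b\<rfloor> = - D - 1" unfolding D_def by linarith
      then have "real_of_int (N - \<lfloor>b - a\<rfloor> + D) \<le> b - a'"
        "real_of_int (N - \<lfloor>b' - a'\<rfloor> - D - 1) \<le> b' - a"
        using 1 2 unfolding D_def le_floor_iff[symmetric] by simp_all
      then show False using lengths assms(3) by linarith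
    qed
  qed
  then show ?thesis using that[of b] that[of b'] by (meson not_le)
qed

section \<open>Linear dependence on a short interval\<close>

lemma ex_vector_killed_by_few_equations:
  fixes v :: "'e \<Rightarrow> nat \<Rightarrow> real"
  assumes "finite E" "card E < 4"
  obtains \<alpha> :: "nat \<Rightarrow> real" and i where "i < 4" "\<alpha> i \<noteq> 0" "\<And>e. e \<in> E \<Longrightarrow> (\<Sum>j<4. \<alpha> j * v e j) = 0"
proof -
  \<comment> \<open>the rows of the system, as vectors of a Euclidean space of dimension 4\<close>
  define w where "w e = (v e 0, v e 1, v e 2, v e 3)" for e
  have "dim (w ` E) \<le> card (w ` E)"
    using assms by (intro dim_le_card') auto
  also have "\<dots> < DIM(real \<times> real \<times> real \<times> real)"
    using card_image_le[OF assms(1), of w] assms(2) by simp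
  finally obtain p :: "real \<times> real \<times> real \<times> real" where p: "p \<noteq> 0" "span (w ` E) \<subseteq> {y. p \<bullet> y = 0}"
    using lowdim_subset_hyperplane by blast
  obtain p0 p1 p2 p3 where pe: "p = (p0, p1, p2, p3)" by (cases p) auto
  define \<alpha> where "\<alpha> j = [p0, p1, p2, p3] ! j" for j
  have "p \<bullet> w e = 0" if "e \<in> E" for e
    using p(2) that by (auto intro: span_base)
  then have "(\<Sum>j<4. \<alpha> j * v e j) = 0" if "e \<in> E" for e
    using that by (fastforce simp: pe w_def \<alpha>_def eval_nat_numeral)
  moreover have "\<exists>i<4. \<alpha> i \<noteq> 0"
  proof (rule ccontr)
    assume "\<not> ?thesis"
    then have "\<alpha> 0 = 0" "\<alpha> 1 = 0" "\<alpha> 2 = 0" "\<alpha> 3 = 0" by auto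
    then show False using p(1) by (simp add: pe \<alpha>_def zero_prod_def)
  qed
  ultimately show ?thesis using that by blast
qed

lemma AE_greaterThanLessThan_infinite:
  fixes x y :: real
  assumes "AE t in lborel. t \<in> {x<..<y} \<longrightarrow> P t" "x < y"
  shows "infinite {t \<in> {x<..<y}. P t}"
proof
  assume fin: "finite {t \<in> {x<..<y}. P t}"
  have "AE t in lborel. t \<notin> {t \<in> {x<..<y}. P t}"
    by (intro AE_not_in finite_imp_null_set_lborel fin)
  with assms(1) have "AE t in lborel. t \<notin> {x<..<y}" by eventually_elim auto
  then have "emeasure lborel {x<..<y} = 0"
    by (subst (asm) AE_iff_measurable[where N = "{x<..<y}"]) auto
  then show False using assms(2) by simp
qed

theorem theorem2:
  fixes \<phi> :: "nat \<Rightarrow> real \<Rightarrow> real"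
    and \<beta>2 \<beta>3 :: "real \<Rightarrow> real"
    and a b c d :: "int \<Rightarrow> real"
  assumes "square_integrable (\<phi> 1)" and "square_integrable (\<phi> 2)"
    and "riesz_basis_shifts 2 \<phi>"
    and "is_bspline 2 \<beta>2" and "is_bspline 3 \<beta>3"
    and "has_L2_sum (\<lambda>k t. a k * \<phi> 1 (t - real_of_int k) + b k * \<phi> 2 (t - real_of_int k)) \<beta>2 UNIV"
    and "has_L2_sum (\<lambda>k t. c k * \<phi> 1 (t - real_of_int k) + d k * \<phi> 2 (t - real_of_int k)) \<beta>3 UNIV"
    and "(\<lambda>k. \<bar>real_of_int k\<bar> ^ 3 * (\<bar>a k\<bar> + \<bar>b k\<bar> + \<bar>c k\<bar> + \<bar>d k\<bar>)) summable_on UNIV"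
  shows "supp_size (\<phi> 1) + supp_size (\<phi> 2) \<ge> 4"
proof (rule ccontr)
  assume "\<not> ?thesis"
  then have "supp_size (\<phi> 1) + supp_size (\<phi> 2) < ennreal 4" by simp
  then obtain p1 q1 p2 q2 where le: "p1 \<le> q1" "p2 \<le> q2"
    and supp1: "ess_support (\<phi> 1) \<subseteq> {p1..q1}" and supp2: "ess_support (\<phi> 2) \<subseteq> {p2..q2}"
    and short: "(q1 - p1) + (q2 - p2) < real_of_int 4"
    by (rule supp_size_add_less_obtain) auto
  from ex_point_few_shifts[OF le short]
  obtain x where few: "(\<lfloor>x - p1\<rfloor> - \<lfloor>x - q1\<rfloor>) + (\<lfloor>x - p2\<rfloor> - \<lfloor>x - q2\<rfloor>) < 4" .
  define J1 where "J1 = {\<lfloor>x - q1\<rfloor><..\<lfloor>x - p1\<rfloor>}"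
  define J2 where "J2 = {\<lfloor>x - q2\<rfloor><..\<lfloor>x - p2\<rfloor>}"
  define m where "m = \<lfloor>x\<rfloor>"
  have "\<forall>\<^sub>F t in at_right x. t < real_of_int m + 1"
    by (intro order_tendstoD(2)[OF tendsto_ident_at]) (unfold m_def, linarith)
  with shifts_right_of_point[where x = x and a = p1 and b = q1]
    shifts_right_of_point[where x = x and a = p2 and b = q2]
  have "\<forall>\<^sub>F t in at_right x. (\<forall>k. t - real_of_int k \<in> {p1..q1} \<longrightarrow> k \<in> J1) \<and>
      (\<forall>k. t - real_of_int k \<in> {p2..q2} \<longrightarrow> k \<in> J2) \<and> t < real_of_int m + 1"
    unfolding J1_def J2_def by eventually_elim blast
  then obtain y where y: "x < y"
    and J1: "\<And>t k. t \<in> {x<..<y} \<Longrightarrow> t - real_of_int k \<in> {p1..q1} \<Longrightarrow> k \<in> J1"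
    and J2: "\<And>t k. t \<in> {x<..<y} \<Longrightarrow> t - real_of_int k \<in> {p2..q2} \<Longrightarrow> k \<in> J2"
    and ym: "\<And>t. t \<in> {x<..<y} \<Longrightarrow> t < real_of_int m + 1"
    by (subst (asm) eventually_at_right) (auto intro: less_add_one)
  have fin: "finite J1" "finite J2" by (auto simp: J1_def J2_def)
  have card: "card (J1 <+> J2) < 4"
    using few floor_mono[of "x - q1" "x - p1"] floor_mono[of "x - q2" "x - p2"] le fin
    by (simp add: card_Plus J1_def J2_def)
  \<comment> \<open>The coefficients of the B-spline shifted by \<open>m - j\<close>, at the active shifts of \<open>\<phi> 1\<close> (left summand)
    and of \<open>\<phi> 2\<close> (right summand). The shifts by \<open>m - 3, \<dots>, m\<close> are the ones that are nonzero on
    the unit interval from \<open>m\<close> to \<open>m + 1\<close>.\<close>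
  define v where "v = case_sum (\<lambda>l j. c (l - m + int j)) (\<lambda>l j. d (l - m + int j))"
  obtain \<alpha> i where \<alpha>: "i < 4" "\<alpha> i \<noteq> 0" "\<And>e. e \<in> J1 <+> J2 \<Longrightarrow> (\<Sum>j<4. \<alpha> j * v e j) = 0"
    using ex_vector_killed_by_few_equations[OF finite_Plus[OF fin] card, of v] by metis
  have \<alpha>c: "(\<Sum>j<4. \<alpha> j * c (l - m + int j)) = 0" if "l \<in> J1" for l
    using \<alpha>(3)[of "Inl l"] that by (simp add: v_def InlI)
  have \<alpha>d: "(\<Sum>j<4. \<alpha> j * d (l - m + int j)) = 0" if "l \<in> J2" for l
    using \<alpha>(3)[of "Inr l"] that by (simp add: v_def InrI)
  have [measurable]: "\<phi> 1 \<in> borel_measurable borel" "\<phi> 2 \<in> borel_measurable borel"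
      "\<beta>3 \<in> borel_measurable borel" "bspline 3 \<in> borel_measurable borel"
    using assms(1,2,5) bspline_fourier[of 3] by (auto simp: square_integrable_def is_bspline_def)
  have zero1: "AE t in lborel. \<forall>k::int. t - real_of_int k \<notin> {p1..q1} \<longrightarrow> \<phi> 1 (t - real_of_int k) = 0"
    and zero2: "AE t in lborel. \<forall>k::int. t - real_of_int k \<notin> {p2..q2} \<longrightarrow> \<phi> 2 (t - real_of_int k) = 0"
    by (intro AE_shifts_zero_outside supp1 supp2; measurable)+
  \<comment> \<open>The expansion of \<open>\<beta>3\<close> is used on the interval moved by \<open>j - m\<close> and then carried back; the index
    \<open>l = k + (m - j)\<close> then names the same shifts of \<open>\<phi> 1\<close> and \<open>\<phi> 2\<close> for every \<open>j\<close>.\<close>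
  have expand: "AE t in lborel. t \<in> {x<..<y} \<longrightarrow>
      bspline 3 (t - real_of_int m + real j)
        = (\<Sum>l\<in>J1 \<union> J2. c (l - m + int j) * \<phi> 1 (t - real_of_int l) + d (l - m + int j) * \<phi> 2 (t - real_of_int l))"
    for j
  proof -
    define h where "h = m - int j"
    define K where "K = (\<lambda>l. l - h) ` (J1 \<union> J2)"
    let ?F = "\<lambda>k t. c k * \<phi> 1 (t - real_of_int k) + d k * \<phi> 2 (t - real_of_int k)"
    have "AE t in lborel. t \<in> {x - h<..<y - h} \<longrightarrow> \<beta>3 t = (\<Sum>k\<in>K. ?F k t)"
    proof (rule has_L2_sum_eq_finite_sum_on[OF assms(7)])
      fix k assume "k \<in> UNIV - K"
      then have k: "k + h \<notin> J1" "k + h \<notin> J2"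
        using image_eqI[of k "\<lambda>l. l - h" "k + h" "J1 \<union> J2"] by (auto simp: K_def)
      show "AE t in lborel. t \<in> {x - h<..<y - h} \<longrightarrow> ?F k t = 0"
        using zero1 zero2
      proof eventually_elim
        case (elim t)
        show ?case
        proof
          assume t: "t \<in> {x - h<..<y - h}"
          then have "t + h \<in> {x<..<y}" by auto
          from J1[OF this, of "k + h"] J2[OF this, of "k + h"] k
          have "t - real_of_int k \<notin> {p1..q1}" "t - real_of_int k \<notin> {p2..q2}" by auto
          with elim show "?F k t = 0" by simp
        qed
      qed
    qed (use fin in \<open>auto simp: K_def\<close>)
    with is_bspline_AE_eq[OF assms(5)]
    have "AE t in lborel. t \<in> {x - h<..<y - h} \<longrightarrow> bspline 3 t = (\<Sum>k\<in>K. ?F k t)"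
      by eventually_elim simp
    then have "AE t in lborel. - real_of_int h + 1 * t \<in> {x - h<..<y - h} \<longrightarrow>
        bspline 3 (- real_of_int h + 1 * t) = (\<Sum>k\<in>K. ?F k (- real_of_int h + 1 * t))"
      by (rule AE_borel_affine[rotated 2]) (simp, measurable)
    then have "AE t in lborel. t \<in> {x<..<y} \<longrightarrow> bspline 3 (t - h) = (\<Sum>k\<in>K. ?F k (t - h))"
      by eventually_elim (simp only: mult_1 uminus_add_conv_diff, simp)
    then show ?thesis
    proof eventually_elim
      case (elim t)
      have "(\<Sum>k\<in>K. ?F k (t - h)) = (\<Sum>l\<in>J1 \<union> J2. ?F (l - h) (t - h))"
        unfolding K_def by (subst sum.reindex) (auto simp: inj_on_def)
      with elim show ?case by (simp add: h_def algebra_simps)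
    qed
  qed
  have "AE t in lborel. \<forall>j\<in>{..<4}. t \<in> {x<..<y} \<longrightarrow>
      bspline 3 (t - real_of_int m + real j)
        = (\<Sum>l\<in>J1 \<union> J2. c (l - m + int j) * \<phi> 1 (t - real_of_int l) + d (l - m + int j) * \<phi> 2 (t - real_of_int l))"
    using expand by (intro AE_finite_allI) auto
  with zero1 zero2
  have "AE t in lborel. t \<in> {x<..<y} \<longrightarrow> (\<Sum>j<4. \<alpha> j * bspline 3 (t - real_of_int m + real j)) = 0"
  proof eventually_elim
    case (elim t)
    show ?case
    proof
      assume t: "t \<in> {x<..<y}"
      have "(\<Sum>j<4. \<alpha> j * bspline 3 (t - real_of_int m + real j))
          = (\<Sum>j<4. \<Sum>l\<in>J1 \<union> J2. \<alpha> j * c (l - m + int j) * \<phi> 1 (t - real_of_int l)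
              + \<alpha> j * d (l - m + int j) * \<phi> 2 (t - real_of_int l))"
        using elim(3) t by (intro sum.cong) (auto simp: sum_distrib_left algebra_simps)
      also have "\<dots> = (\<Sum>l\<in>J1 \<union> J2. (\<Sum>j<4. \<alpha> j * c (l - m + int j)) * \<phi> 1 (t - real_of_int l)
              + (\<Sum>j<4. \<alpha> j * d (l - m + int j)) * \<phi> 2 (t - real_of_int l))"
        by (subst sum.swap) (simp add: sum.distrib sum_distrib_right)
      also have "\<dots> = 0"
      proof (intro sum.neutral ballI)
        fix l
        \<comment> \<open>An active shift has coefficient 0 by the choice of \<open>\<alpha>\<close>, and any other shift is 0 at \<open>t\<close>.\<close>
        have "(\<Sum>j<4. \<alpha> j * c (l - m + int j)) = 0 \<or> \<phi> 1 (t - real_of_int l) = 0"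
          using \<alpha>c[of l] J1[OF t, of l] elim(1) by blast
        moreover have "(\<Sum>j<4. \<alpha> j * d (l - m + int j)) = 0 \<or> \<phi> 2 (t - real_of_int l) = 0"
          using \<alpha>d[of l] J2[OF t, of l] elim(2) by blast
        ultimately show "(\<Sum>j<4. \<alpha> j * c (l - m + int j)) * \<phi> 1 (t - real_of_int l)
              + (\<Sum>j<4. \<alpha> j * d (l - m + int j)) * \<phi> 2 (t - real_of_int l) = 0"
          by auto
      qed
      finally show "(\<Sum>j<4. \<alpha> j * bspline 3 (t - real_of_int m + real j)) = 0" .
    qed
  qed
  then have "infinite {t \<in> {x<..<y}. (\<Sum>j<4. \<alpha> j * bspline 3 (t - real_of_int m + real j)) = 0}"
    (is "infinite ?T") using y by (rule AE_greaterThanLessThan_infinite)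
  then have "infinite ((\<lambda>t. t - real_of_int m) ` ?T)"
    by (subst finite_image_iff) (auto simp: inj_on_def)
  moreover have "(\<lambda>t. t - real_of_int m) ` ?T \<subseteq> {0<..<1}"
  proof clarsimp
    fix t assume "x < t" "t < y"
    then show "real_of_int m < t \<and> t - real_of_int m < 1"
      using ym[of t] le_less_trans[OF of_int_floor_le \<open>x < t\<close>] by (auto simp: m_def)
  qed
  ultimately have "\<alpha> i = 0"
    by (rule cubic_bspline_shifts_independent) (use \<alpha>(1) in auto)
  with \<alpha>(2) show False by simp
qed

end
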